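(* Let $\delta>0$, let $\theta_0=\pi/2$, and let $$\nu_\delta=\left\lceil \log_2\frac{\pi}{2\operatorname{arcsec}(1+\delta)}\right\rceil .$$ Assume that $\log_2\frac{\pi}{2\operatorname{arcsec}(1+\delta)}\notin\mathbb{Z}$. Then there exist values $\theta_j\in(0,\pi/2)$ with $\sin(\theta_j)\in\mathbb{Q}$ and $\cos(\theta_j)\in\mathbb{Q}$, $j=1,\dots,\nu_\delta$, such that $P^{\nu_\delta}(\theta)$ is a rational $(1+\delta)$-approximation of $L^3$; that is, all coefficients in the system defining $P^{\nu_\delta}(\theta)$ are rational and $$L^3\subseteq P^{\nu_\delta}(\theta)\subseteq(1+\delta)L^3 .$$
   Context: $L^3=\{x\in\mathbb{R}^3:\sqrt{x_1^2+x_2^2}\le x_3\}$, and for $\lambda\ge 1$ the notation $\lambda L^3$ denotes the relaxed cone $\{x\in\mathbb{R}^3:\sqrt{x_1^2+x_2^2}\le\lambda x_3\}$ (not the pointwise scaling of $L^3$). Here $\operatorname{arcsec}:[1,\infty)\to[0,\pi/2)$ is the inverse of $\sec$. For a positive integer $\nu$ and angles $\theta=(\theta_1,\dots,\theta_\nu)$ with $\theta_j\in(0,\pi/2)$, $P^\nu(\theta)$ is the set of $x\in\mathbb{R}^3$ for which there exist reals $\xi^j,\eta^j$, $j=0,\dots,\nu$, satisfying - $\xi^0\ge|x_1|$, $\eta^0\ge|x_2|$; - $\xi^j=\cos(\theta_j)\xi^{j-1}+\sin(\theta_j)\eta^{j-1}$ for $j=1,\dots,\nu$; - $\eta^j\ge|-\sin(\theta_j)\xi^{j-1}+\cos(\theta_j)\eta^{j-1}|$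 for $j=1,\dots,\nu$; - $\xi^\nu\le x_3$ and $\eta^\nu\le\tan(\theta_\nu)\xi^\nu$. *)

theory Defs
  imports "HOL-Analysis.Analysis"
begin

definition sec :: "real \<Rightarrow> real" where
  "sec t = 1 / cos t"

definition arcsec :: "real \<Rightarrow> real" where
  "arcsec = the_inv_into {0..<pi/2} sec"

definition L3 :: "(real^3) set" where
  "L3 = {x. sqrt ((x$1)\<^sup>2 + (x$2)\<^sup>2) \<le> x$3}"

definition relaxed_L3 :: "real \<Rightarrow> (real^3) set" where
  "relaxed_L3 lam = {x. sqrt ((x$1)\<^sup>2 + (x$2)\<^sup>2) \<le> lam * x$3}"

text \<open>For \<open>\<delta> > 0\<close> the logarithm is positive, as \<open>arcsec (1 + \<delta>) < pi/2\<close>, so the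
  conversion to \<^typ>\<open>nat\<close> does not truncate.\<close>

definition log_ratio :: "real \<Rightarrow> real" where
  "log_ratio \<delta> = log 2 (pi / (2 * arcsec (1 + \<delta>)))"

definition nu :: "real \<Rightarrow> nat" where
  "nu \<delta> = nat \<lceil>log_ratio \<delta>\<rceil>"

text \<open>Only \<open>\<theta> 1, \<dots>, \<theta> \<nu>\<close> matter in the following set.\<close>

definition P_cone :: "nat \<Rightarrow> (nat \<Rightarrow> real) \<Rightarrow> (real^3) set" where
  "P_cone \<nu> \<theta> = {x. \<exists>\<xi> \<eta> :: nat \<Rightarrow> real.
      \<xi> 0 \<ge> \<bar>x$1\<bar> \<and> \<eta> 0 \<ge> \<bar>x$2\<bar> \<and>
      (\<forall>j\<in>{1..\<nu>}. \<xi> j = cos (\<theta> j) * \<xi> (j-1) + sin (\<theta> j) * \<eta> (j-1)) \<and>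
      (\<forall>j\<in>{1..\<nu>}. \<eta> j \<ge> \<bar>- sin (\<theta> j) * \<xi> (j-1) + cos (\<theta> j) * \<eta> (j-1)\<bar>) \<and>
      \<xi> \<nu> \<le> x$3 \<and> \<eta> \<nu> \<le> tan (\<theta> \<nu>) * \<xi> \<nu>}"

text \<open>
  Rationality of the coefficients is a property of the defining system rather than of the set
  \<^const>\<open>P_cone\<close>. The system is therefore also given as an explicit set of constraints
  between linear forms; lemma \<open>P_cone_eq_projection\<close> below shows that it defines
  \<^const>\<open>P_cone\<close>. \<open>AbsLe l r\<close> stands for \<open>\<bar>l\<bar> \<le> r\<close>, that is, for the two linear
  inequalities \<open>l \<le> r\<close> and \<open>- l \<le> r\<close>, which have the same coefficients up to sign.
\<close>

datatype sysvar = X 3 | Xi nat | Eta nat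

type_synonym linform = "(real \<times> sysvar) list"

datatype constr = Le linform linform | Eq linform linform | AbsLe linform linform

definition form_val :: "(sysvar \<Rightarrow> real) \<Rightarrow> linform \<Rightarrow> real" where
  "form_val v l = (\<Sum>(a, y)\<leftarrow>l. a * v y)"

fun satisfies :: "(sysvar \<Rightarrow> real) \<Rightarrow> constr \<Rightarrow> bool" where
  "satisfies v (Le l r) = (form_val v l \<le> form_val v r)"
| "satisfies v (Eq l r) = (form_val v l = form_val v r)"
| "satisfies v (AbsLe l r) = (\<bar>form_val v l\<bar> \<le> form_val v r)"

fun coefficients :: "constr \<Rightarrow> real set" where
  "coefficients (Le l r) = fst ` set (l @ r)"
| "coefficients (Eq l r) = fst ` set (l @ r)"
| "coefficients (AbsLe l r) = fst ` set (l @ r)"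

definition projection :: "constr set \<Rightarrow> (real^3) set" where
  "projection S = {x. \<exists>v. (\<forall>i. v (X i) = x$i) \<and> (\<forall>c\<in>S. satisfies v c)}"

definition P_system :: "nat \<Rightarrow> (nat \<Rightarrow> real) \<Rightarrow> constr set" where
  "P_system \<nu> \<theta> =
     {AbsLe [(1, X 1)] [(1, Xi 0)], AbsLe [(1, X 2)] [(1, Eta 0)]} \<union>
     (\<Union>j\<in>{1..\<nu>}.
        {Eq [(1, Xi j)] [(cos (\<theta> j), Xi (j-1)), (sin (\<theta> j), Eta (j-1))],
         AbsLe [(- sin (\<theta> j), Xi (j-1)), (cos (\<theta> j), Eta (j-1))] [(1, Eta j)]}) \<union>
     {Le [(1, Xi \<nu>)] [(1, X 3)], Le [(1, Eta \<nu>)] [(tan (\<theta> \<nu>), Xi \<nu>)]}"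

definition rational_system :: "constr set \<Rightarrow> bool" where
  "rational_system S \<longleftrightarrow> (\<forall>c\<in>S. coefficients c \<subseteq> \<rat>)"

lemma P_cone_eq_projection: "P_cone \<nu> \<theta> = projection (P_system \<nu> \<theta>)"
proof (intro set_eqI iffI)
  fix x assume "x \<in> P_cone \<nu> \<theta>"
  then obtain \<xi> \<eta> where h:
      "\<bar>x$1\<bar> \<le> \<xi> 0" "\<bar>x$2\<bar> \<le> \<eta> 0"
      "\<forall>j\<in>{1..\<nu>}. \<xi> j = cos (\<theta> j) * \<xi> (j-1) + sin (\<theta> j) * \<eta> (j-1)"
      "\<forall>j\<in>{1..\<nu>}. \<bar>- sin (\<theta> j) * \<xi> (j-1) + cos (\<theta> j) * \<eta> (j-1)\<bar> \<le> \<eta> j"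
      "\<xi> \<nu> \<le> x$3" "\<eta> \<nu> \<le> tan (\<theta> \<nu>) * \<xi> \<nu>"
    unfolding P_cone_def by blast
  define v where "v = case_sysvar (\<lambda>i. x$i) \<xi> \<eta>"
  have "\<forall>c\<in>P_system \<nu> \<theta>. satisfies v c"
    using h unfolding P_system_def by (auto simp: form_val_def v_def)
  then show "x \<in> projection (P_system \<nu> \<theta>)"
    unfolding projection_def by (auto intro!: exI[of _ v] simp: v_def)
next
  fix x assume "x \<in> projection (P_system \<nu> \<theta>)"
  then obtain v where v: "\<And>i. v (X i) = x$i" and s: "\<forall>c\<in>P_system \<nu> \<theta>. satisfies v c"
    unfolding projection_def by blast
  show "x \<in> P_cone \<nu> \<theta>"
    unfolding P_cone_def mem_Collect_eq
    by (rule exI[of _ "\<lambda>j. v (Xi j)"], rule exI[of _ "\<lambda>j. v (Eta j)"])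
      (use s in \<open>auto simp: P_system_def form_val_def v ball_Un\<close>)
qed

end

theory Submission
  imports Defs
begin

text \<open>
  If \<open>(\<xi>\<^sup>0, \<eta>\<^sup>0)\<close> has polar angle \<open>\<phi> \<in> [0, \<pi>/2]\<close>, then step \<open>j\<close> rotates it clockwise by
  \<open>\<theta>\<^sub>j\<close> and folds it back into the upper half plane, so \<open>\<phi>\<close> becomes \<open>\<bar>\<phi> - \<theta>\<^sub>j\<bar>\<close>. When
  \<open>\<theta>\<^sub>j \<ge> \<theta>\<^bsub>j-1\<^esub>/2\<close> for all \<open>j\<close>, the angle after step \<open>j\<close> is at most \<open>\<theta>\<^sub>j\<close>, which yields the inner
  inclusion. No step decreases the Euclidean norm, and the last constraint bounds the norm by
  \<open>sec \<theta>\<^sub>\<nu> \<xi>\<^sup>\<nu>\<close>, which yields the outer one if \<open>\<theta>\<^sub>\<nu> \<le> arcsec (1 + \<delta>)\<close>. The exact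
  bisection \<open>\<theta>\<^sub>j = \<pi>/2\<^bsup>j+1\<^esup>\<close> meets this last bound strictly, because the logarithm is not an
  integer; the slack and the density of the angles \<open>2 arctan t\<close> with rational \<open>t\<close> allow a
  perturbation to angles with rational sine and cosine.
\<close>

text \<open>By the half-angle formulas, \<open>sin t\<close> and \<open>cos t\<close> are rational
  functions of \<open>tan (t / 2)\<close>, so density of the rationals between
  \<open>tan (a / 2)\<close> and \<open>tan (b / 2)\<close> carries over to angles.\<close>

lemma rational_angle_dense:
  fixes a b :: real
  assumes "0 \<le> a" "a < b" "b \<le> pi / 2"
  obtains t where "a < t" "t < b" "sin t \<in> \<rat>" "cos t \<in> \<rat>"
proof -
  have "tan (a / 2) < tan (b / 2)"
    using assms pi_gt_zero by (intro tan_monotone) linarith+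
  then obtain q where q: "q \<in> \<rat>" "tan (a / 2) < q" "q < tan (b / 2)"
    using Rats_dense_in_real by blast
  define s where "s = arctan q"
  have "a / 2 = arctan (tan (a / 2))" "b / 2 = arctan (tan (b / 2))"
    using assms pi_gt_zero by (intro arctan_tan[symmetric]; linarith)+
  then have s: "a / 2 < s" "s < b / 2"
    using q(2,3) by (metis s_def arctan_less_iff)+
  have "cos s \<noteq> 0" "tan s = q"
    by (simp_all add: s_def tan_arctan)
  then have "sin (2 * s) = 2 * q / (1 + q\<^sup>2)" "cos (2 * s) = (1 - q\<^sup>2) / (1 + q\<^sup>2)"
    using sin_tan_half[of s] cos_tan_half[of s] by simp_all
  then have "sin (2 * s) \<in> \<rat>" "cos (2 * s) \<in> \<rat>"
    using q(1) by simp_all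
  then show thesis
    using that[of "2 * s"] s by simp
qed

text \<open>Angles are chosen one after another: \<open>\<theta> j < c / 2 ^ j\<close> puts
  \<open>\<theta> j / 2\<close> strictly below \<open>c / 2 ^ Suc j\<close>, which leaves an open
  interval for the next angle.\<close>

lemma rational_angle_sequence:
  fixes c :: real
  assumes "pi / 2 < c"
  obtains \<theta> :: "nat \<Rightarrow> real" where "\<theta> 0 = pi / 2"
    "\<And>j. \<theta> (Suc j) \<in> {0<..<pi/2}" "\<And>j. sin (\<theta> (Suc j)) \<in> \<rat>" "\<And>j. cos (\<theta> (Suc j)) \<in> \<rat>"
    "\<And>j. \<theta> j / 2 \<le> \<theta> (Suc j)" "\<And>j. \<theta> j < c / 2 ^ j"
proof -
  define P where "P n t \<longleftrightarrow> 0 < t \<and> t \<le> pi / 2 \<and> t < c / 2 ^ n \<and>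
    (if n = 0 then t = pi / 2 else t < pi / 2 \<and> sin t \<in> \<rat> \<and> cos t \<in> \<rat>)" for n :: nat and t :: real
  define Q where "Q = (\<lambda>(n::nat) (s::real) t. s / 2 \<le> t)"
  have "\<exists>f. \<forall>n. P n (f n) \<and> Q n (f n) (f (Suc n))"
  proof (rule dependent_nat_choice)
    show "\<exists>t. P 0 t"
      using assms by (intro exI[of _ "pi / 2"]) (simp add: P_def)
  next
    fix s n assume "P n s"
    then have s: "0 < s" "s \<le> pi / 2" "s / 2 < c / 2 ^ Suc n"
      by (auto simp: P_def field_simps)
    \<comment> \<open>The bound \<open>s\<close> in the minimum makes the angles decrease, so that
      all after the initial \<open>pi / 2\<close> lie strictly below it.\<close>
    obtain t where "s / 2 < t" "t < min s (c / 2 ^ Suc n)" "sin t \<in> \<rat>" "cos t \<in> \<rat>"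
      by (rule rational_angle_dense[of "s / 2" "min s (c / 2 ^ Suc n)"]) (use s in auto)
    then show "\<exists>t. P (Suc n) t \<and> Q n s t"
      using s by (intro exI[of _ t]) (auto simp: P_def Q_def)
  qed
  then obtain f where f: "\<And>n. P n (f n)" "\<And>n. Q n (f n) (f (Suc n))"
    by blast
  show thesis
  proof (rule that[of f])
    show "f 0 = pi / 2"
      using f(1)[of 0] by (simp add: P_def)
    show "f (Suc j) \<in> {0<..<pi/2}" "sin (f (Suc j)) \<in> \<rat>" "cos (f (Suc j)) \<in> \<rat>" for j
      using f(1)[of "Suc j"] by (simp_all add: P_def)
    show "f j / 2 \<le> f (Suc j)" for j
      using f(2)[of j] by (simp add: Q_def)
    show "f j < c / 2 ^ j" for j
      using f(1)[of j] by (simp add: P_def)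
  qed
qed

text \<open>The witnesses start at equality, \<open>\<xi> 0 = \<bar>x$1\<bar>\<close> and
  \<open>\<eta> 0 = \<bar>x$2\<bar>\<close>, and keep the norm \<open>r\<close> at every step, so
  only a polar angle has to be tracked.\<close>

lemma L3_subset_P_cone:
  assumes "\<theta> 0 = pi / 2" and half: "\<And>j. \<theta> j / 2 \<le> \<theta> (Suc j)"
    and le: "\<And>j. \<theta> j \<le> pi / 2" and last: "\<theta> \<nu> < pi / 2"
  shows "L3 \<subseteq> P_cone \<nu> \<theta>"
proof
  fix x assume "x \<in> L3"
  define r where "r = sqrt ((x$1)\<^sup>2 + (x$2)\<^sup>2)"
  have r: "0 \<le> r" "r \<le> x$3" "r\<^sup>2 = (x$1)\<^sup>2 + (x$2)\<^sup>2"
    using \<open>x \<in> L3\<close> by (auto simp: r_def L3_def)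
  obtain p where p: "0 \<le> p" "p \<le> pi / 2" "\<bar>x$1\<bar> = r * cos p" "\<bar>x$2\<bar> = r * sin p"
  proof (cases "r = 0")
    case True
    then show thesis
      using that[of 0] r(3) by simp
  next
    case False
    then have "(\<bar>x$1\<bar> / r)\<^sup>2 + (\<bar>x$2\<bar> / r)\<^sup>2 = 1"
      by (simp add: power_divide r(3)[symmetric] flip: add_divide_distrib)
    then obtain p where "0 \<le> p" "p \<le> pi / 2" "\<bar>x$1\<bar> / r = cos p" "\<bar>x$2\<bar> / r = sin p"
      using sincos_total_pi_half[of "\<bar>x$1\<bar> / r" "\<bar>x$2\<bar> / r"] r(1) by auto
    then show thesis
      using that[of p] False by (simp add: field_simps)
  qed
  define \<phi> where "\<phi> = rec_nat p (\<lambda>j a. \<bar>a - \<theta> (Suc j)\<bar>)"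
  have \<phi>_0: "\<phi> 0 = p" and \<phi>_Suc: "\<phi> (Suc j) = \<bar>\<phi> j - \<theta> (Suc j)\<bar>" for j
    by (simp_all add: \<phi>_def)
  \<comment> \<open>Since
    \<open>0 \<le> \<phi> j \<le> \<theta> j \<le> 2 * \<theta> (Suc j)\<close>, the distance from
    \<open>\<phi> j\<close> to \<open>\<theta> (Suc j)\<close> is at most
    \<open>\<theta> (Suc j)\<close>.\<close>
  have \<phi>: "0 \<le> \<phi> j \<and> \<phi> j \<le> \<theta> j" for j
  proof (induction j)
    case 0
    then show ?case using p assms by (simp add: \<phi>_0)
  next
    case (Suc j)
    then show ?case using half[of j] unfolding \<phi>_Suc by linarith
  qed
  have xi: "r * cos (\<phi> (Suc j)) = cos (\<theta> (Suc j)) * (r * cos (\<phi> j)) + sin (\<theta> (Suc j)) * (r * sin (\<phi> j))" for j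
    by (simp add: \<phi>_Suc cos_diff algebra_simps)
  have eta: "\<bar>- sin (\<theta> (Suc j)) * (r * cos (\<phi> j)) + cos (\<theta> (Suc j)) * (r * sin (\<phi> j))\<bar> \<le> r * sin (\<phi> (Suc j))" for j
  proof -
    have "- sin (\<theta> (Suc j)) * (r * cos (\<phi> j)) + cos (\<theta> (Suc j)) * (r * sin (\<phi> j))
        = r * sin (\<phi> j - \<theta> (Suc j))"
      by (simp add: sin_diff algebra_simps)
    moreover have "\<bar>sin u\<bar> = \<bar>sin \<bar>u\<bar>\<bar>" for u :: real
      by (cases "0 \<le> u") simp_all
    then have "\<bar>sin (\<phi> j - \<theta> (Suc j))\<bar> = \<bar>sin (\<phi> (Suc j))\<bar>"
      by (simp only: \<phi>_Suc)
    moreover have "0 \<le> sin (\<phi> (Suc j))"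
      using \<phi>[of "Suc j"] le[of "Suc j"] by (intro sin_ge_zero) auto
    ultimately show ?thesis
      using r(1) by (simp add: abs_mult)
  qed
  have last_angle: "0 \<le> \<phi> \<nu>" "\<phi> \<nu> \<le> \<theta> \<nu>"
    using \<phi>[of \<nu>] by auto
  have "sin (\<phi> \<nu>) = tan (\<phi> \<nu>) * cos (\<phi> \<nu>)"
    using last_angle last cos_gt_zero_pi[of "\<phi> \<nu>"] by (simp add: tan_def)
  also have "\<dots> \<le> tan (\<theta> \<nu>) * cos (\<phi> \<nu>)"
    using last_angle last by (intro mult_right_mono tan_mono_le cos_ge_zero) linarith+
  finally have "r * sin (\<phi> \<nu>) \<le> tan (\<theta> \<nu>) * (r * cos (\<phi> \<nu>))"
    using r(1) by (simp add: mult_left_mono mult.left_commute)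
  moreover have "\<bar>x$2\<bar> \<le> r * sin (\<phi> 0)"
    using p(4) by (simp add: \<phi>_0)
  moreover have "r * cos (\<phi> \<nu>) \<le> x$3"
    using r(1,2) mult_left_mono[OF cos_le_one r(1), of "\<phi> \<nu>"] by simp
  moreover have "\<bar>x$1\<bar> \<le> r * cos (\<phi> 0)"
    using p(3) by (simp add: \<phi>_0)
  moreover have "r * cos (\<phi> j) = cos (\<theta> j) * (r * cos (\<phi> (j - 1))) + sin (\<theta> j) * (r * sin (\<phi> (j - 1)))"
    "\<bar>- sin (\<theta> j) * (r * cos (\<phi> (j - 1))) + cos (\<theta> j) * (r * sin (\<phi> (j - 1)))\<bar> \<le> r * sin (\<phi> j)"
    if "j \<in> {1..\<nu>}" for j
    using xi[of "j - 1"] eta[of "j - 1"] that by simp_all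
  ultimately show "x \<in> P_cone \<nu> \<theta>"
    unfolding P_cone_def mem_Collect_eq
    by (intro exI[of _ "\<lambda>j. r * cos (\<phi> j)"] exI[of _ "\<lambda>j. r * sin (\<phi> j)"] conjI ballI)
qed

lemma P_cone_subset_relaxed_L3:
  assumes "0 < \<theta> \<nu>" "\<theta> \<nu> < pi / 2"
  shows "P_cone \<nu> \<theta> \<subseteq> relaxed_L3 (sec (\<theta> \<nu>))"
proof
  fix x assume "x \<in> P_cone \<nu> \<theta>"
  then obtain \<xi> \<eta> where h:
      "\<bar>x$1\<bar> \<le> \<xi> 0" "\<bar>x$2\<bar> \<le> \<eta> 0"
      "\<forall>j\<in>{1..\<nu>}. \<xi> j = cos (\<theta> j) * \<xi> (j-1) + sin (\<theta> j) * \<eta> (j-1)"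
      "\<forall>j\<in>{1..\<nu>}. \<bar>- sin (\<theta> j) * \<xi> (j-1) + cos (\<theta> j) * \<eta> (j-1)\<bar> \<le> \<eta> j"
      "\<xi> \<nu> \<le> x$3" "\<eta> \<nu> \<le> tan (\<theta> \<nu>) * \<xi> \<nu>"
    unfolding P_cone_def by blast
  have norm_mono: "j \<le> \<nu> \<Longrightarrow> (x$1)\<^sup>2 + (x$2)\<^sup>2 \<le> (\<xi> j)\<^sup>2 + (\<eta> j)\<^sup>2 \<and> 0 \<le> \<eta> j" for j
  proof (induction j)
    case 0
    have "(x$1)\<^sup>2 \<le> (\<xi> 0)\<^sup>2" "(x$2)\<^sup>2 \<le> (\<eta> 0)\<^sup>2"
      using h(1,2) by (simp_all add: abs_le_square_iff[symmetric])
    then show ?case using h(2) by auto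
  next
    case (Suc j)
    \<comment> \<open>The second coordinate after the rotation, before folding: the rotation
      preserves the norm, and replacing \<open>u\<close> by \<open>\<eta> (Suc j)\<close> can only
      increase it.\<close>
    define u where "u = - sin (\<theta> (Suc j)) * \<xi> j + cos (\<theta> (Suc j)) * \<eta> j"
    have xi: "\<xi> (Suc j) = cos (\<theta> (Suc j)) * \<xi> j + sin (\<theta> (Suc j)) * \<eta> j" and u: "\<bar>u\<bar> \<le> \<eta> (Suc j)"
      using h(3,4) Suc.prems by (auto simp: u_def dest: bspec[where x = "Suc j"])
    have "(\<xi> (Suc j))\<^sup>2 + u\<^sup>2 =
        ((sin (\<theta> (Suc j)))\<^sup>2 + (cos (\<theta> (Suc j)))\<^sup>2) * ((\<xi> j)\<^sup>2 + (\<eta> j)\<^sup>2)"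
      unfolding xi u_def by algebra
    moreover have "u\<^sup>2 \<le> (\<eta> (Suc j))\<^sup>2"
      using u by (simp add: abs_le_square_iff[symmetric])
    ultimately show ?case
      using Suc u by simp
  qed
  have c: "0 < cos (\<theta> \<nu>)" and t: "0 < tan (\<theta> \<nu>)"
    using assms by (auto intro!: cos_gt_zero tan_gt_zero)
  \<comment> \<open>The sign comes from \<open>0 \<le> \<eta> \<nu> \<le> tan (\<theta> \<nu>) *
    \<xi> \<nu>\<close> with a positive tangent; it allows \<open>\<xi> \<nu> \<le> x$3\<close> to
    be squared below.\<close>
  have xi: "0 \<le> \<xi> \<nu>"
    using norm_mono[of \<nu>] order_trans[OF _ h(6), of 0] t by (simp add: zero_le_mult_iff)
  have "(\<eta> \<nu>)\<^sup>2 \<le> (tan (\<theta> \<nu>) * \<xi> \<nu>)\<^sup>2"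
    using norm_mono[of \<nu>] h(6) by (intro power_mono) auto
  then have "(x$1)\<^sup>2 + (x$2)\<^sup>2 \<le> (1 + (tan (\<theta> \<nu>))\<^sup>2) * (\<xi> \<nu>)\<^sup>2"
    using norm_mono[of \<nu>] by (simp add: algebra_simps power_mult_distrib)
  also have "\<dots> = (sec (\<theta> \<nu>) * \<xi> \<nu>)\<^sup>2"
    using tan_sec[of "\<theta> \<nu>"] c by (simp add: sec_def power_divide inverse_eq_divide)
  also have "\<dots> \<le> (sec (\<theta> \<nu>) * x$3)\<^sup>2"
    using xi h(5) c by (intro power_mono mult_left_mono) (auto simp: sec_def)
  finally have "sqrt ((x$1)\<^sup>2 + (x$2)\<^sup>2) \<le> sec (\<theta> \<nu>) * x$3"
    using xi h(5) c by (intro real_le_lsqrt) (auto simp: sec_def)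
  then show "x \<in> relaxed_L3 (sec (\<theta> \<nu>))"
    by (simp add: relaxed_L3_def)
qed

text \<open>Makes the range and monotonicity facts about \<open>arccos\<close> available for
  \<open>arcsec\<close>.\<close>

lemma arcsec_eq_arccos:
  assumes "1 \<le> y"
  shows "arcsec y = arccos (1 / y)"
proof -
  have y: "0 < 1 / y" "1 / y \<le> 1"
    using assms by simp_all
  have "inj_on sec {0..<pi/2}"
    using cos_inj_pi by (auto simp: inj_on_def sec_def)
  moreover have "0 \<le> arccos (1 / y)" "arccos (1 / y) < pi / 2"
    using y arccos_lbound[of "1 / y"] arccos_less_arccos[of 0 "1 / y"] arccos_0 by linarith+
  moreover have "cos (arccos (1 / y)) = 1 / y"
    using y by (intro cos_arccos) linarith+
  then have "sec (arccos (1 / y)) = y"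
    by (simp add: sec_def)
  ultimately show ?thesis
    unfolding arcsec_def by (intro the_inv_into_f_eq) auto
qed

theorem proposition2:
  fixes \<delta> :: real
  assumes "\<delta> > 0"
    and "log_ratio \<delta> \<notin> \<int>"
  shows "\<exists>\<theta> :: nat \<Rightarrow> real.
    \<theta> 0 = pi / 2 \<and>
    (\<forall>j\<in>{1..nu \<delta>}. \<theta> j \<in> {0<..<pi/2} \<and> sin (\<theta> j) \<in> \<rat> \<and> cos (\<theta> j) \<in> \<rat>) \<and>
    rational_system (P_system (nu \<delta>) \<theta>) \<and>
    L3 \<subseteq> P_cone (nu \<delta>) \<theta> \<and>
    P_cone (nu \<delta>) \<theta> \<subseteq> relaxed_L3 (1 + \<delta>)"
proof -
  define \<alpha> where "\<alpha> = arcsec (1 + \<delta>)"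
  define \<nu> where "\<nu> = nu \<delta>"
  have arc: "\<alpha> = arccos (1 / (1 + \<delta>))"
    using assms(1) by (simp add: \<alpha>_def arcsec_eq_arccos)
  have "0 < 1 / (1 + \<delta>)" "1 / (1 + \<delta>) < 1"
    using assms(1) by simp_all
  then have \<alpha>: "0 < \<alpha>" "\<alpha> < pi / 2" and cos_\<alpha>: "cos \<alpha> = 1 / (1 + \<delta>)"
    unfolding arc using arccos_less_arccos[of "1 / (1 + \<delta>)" 1]
      arccos_less_arccos[of 0 "1 / (1 + \<delta>)"] cos_arccos[of "1 / (1 + \<delta>)"] arccos_0 arccos_1
    by linarith+
  have ratio: "1 < pi / (2 * \<alpha>)"
    using \<alpha> by (simp add: field_simps)
  then have pos: "0 < log_ratio \<delta>"
    by (simp add: log_ratio_def \<alpha>_def)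
  then have "0 < \<nu>"
    by (simp add: \<nu>_def nu_def)
  \<comment> \<open>Here non-integrality enters: rounding up is strict, which gives
    \<open>pi / 2 < 2 ^ \<nu> * \<alpha>\<close>. With this product as the constant \<open>c\<close>
    of the angle sequence, the bound at index \<open>\<nu>\<close> reads
    \<open>\<theta> \<nu> < \<alpha>\<close>.\<close>
  have "log_ratio \<delta> \<noteq> of_int \<lceil>log_ratio \<delta>\<rceil>"
    using assms(2) by (metis Ints_of_int)
  then have "log_ratio \<delta> < real \<nu>"
    using pos by (simp add: \<nu>_def nu_def order_less_le)
  then have "pi / (2 * \<alpha>) < 2 ^ \<nu>"
    using ratio by (simp add: log_ratio_def \<alpha>_def log_less_iff powr_realpow)
  then have "pi / 2 < 2 ^ \<nu> * \<alpha>"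
    using \<alpha>(1) by (simp add: field_simps)
  then obtain \<theta> :: "nat \<Rightarrow> real" where \<theta>: "\<theta> 0 = pi / 2"
    "\<And>j. \<theta> (Suc j) \<in> {0<..<pi/2}" "\<And>j. sin (\<theta> (Suc j)) \<in> \<rat>" "\<And>j. cos (\<theta> (Suc j)) \<in> \<rat>"
    "\<And>j. \<theta> j / 2 \<le> \<theta> (Suc j)" "\<And>j. \<theta> j < 2 ^ \<nu> * \<alpha> / 2 ^ j"
    using rational_angle_sequence by blast
  have rat: "\<theta> j \<in> {0<..<pi/2}" "sin (\<theta> j) \<in> \<rat>" "cos (\<theta> j) \<in> \<rat>" if "1 \<le> j" for j
    using \<theta>(2-4)[of "j - 1"] that by simp_all
  have last: "0 < \<theta> \<nu>" "\<theta> \<nu> < pi / 2" "\<theta> \<nu> < \<alpha>"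
    using rat(1)[of \<nu>] \<open>0 < \<nu>\<close> \<theta>(6)[of \<nu>] by simp_all
  have "tan (\<theta> \<nu>) \<in> \<rat>"
    using rat[of \<nu>] \<open>0 < \<nu>\<close> by (simp add: tan_def)
  then have "rational_system (P_system \<nu> \<theta>)"
    using rat by (auto simp: rational_system_def P_system_def)
  moreover have "L3 \<subseteq> P_cone \<nu> \<theta>"
  proof (rule L3_subset_P_cone[OF \<theta>(1,5) _ last(2)])
    show "\<theta> j \<le> pi / 2" for j
      using \<theta>(1) rat(1)[of j] by (cases j) auto
  qed
  moreover have "P_cone \<nu> \<theta> \<subseteq> relaxed_L3 (1 + \<delta>)"
  proof -
    have "cos \<alpha> \<le> cos (\<theta> \<nu>)"
      using last \<alpha> by (intro cos_monotone_0_pi_le) auto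
    then have le: "sec (\<theta> \<nu>) \<le> 1 + \<delta>"
      using assms(1) cos_\<alpha> last cos_gt_zero[of "\<theta> \<nu>"] by (simp add: sec_def field_simps)
    have "0 < sec (\<theta> \<nu>)"
      using last by (simp add: sec_def cos_gt_zero)
    \<comment> \<open>A larger factor weakens the inequality only where \<open>x$3\<close> is
      nonnegative, which the nonnegative square root guarantees on the smaller cone.\<close>
    have "relaxed_L3 (sec (\<theta> \<nu>)) \<subseteq> relaxed_L3 (1 + \<delta>)"
    proof
      fix x assume "x \<in> relaxed_L3 (sec (\<theta> \<nu>))"
      then have x: "sqrt ((x$1)\<^sup>2 + (x$2)\<^sup>2) \<le> sec (\<theta> \<nu>) * x$3"
        by (simp add: relaxed_L3_def)
      then have "0 \<le> sec (\<theta> \<nu>) * x$3"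
        by (rule order_trans[rotated]) simp
      then have "0 \<le> x$3"
        using \<open>0 < sec (\<theta> \<nu>)\<close> by (simp add: zero_le_mult_iff)
      then show "x \<in> relaxed_L3 (1 + \<delta>)"
        using x mult_right_mono[OF le] by (force simp: relaxed_L3_def)
    qed
    then show ?thesis
      using P_cone_subset_relaxed_L3[of \<theta> \<nu>] last(1,2) by blast
  qed
  ultimately show ?thesis
    using \<theta>(1) rat by (intro exI[of _ \<theta>]) (auto simp: \<nu>_def)
qed

end
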